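(* Let $s\ge 1$ and $q$ be integers with $0\le q\le s$, let $n=T_s+q$, and let $\lambda\vdash n$ satisfy $\deg(\lambda)=\Delta_n$, written in compressed form with support size $s$ (every such $\lambda$ has exactly $s$ distinct part sizes) as $\lambda=(L_1^{m_1},\dots,L_s^{m_s})$ with gaps $g_1,\dots,g_s$. Write $g_i=1+x_i$ and $m_i=1+y_i$ with $x_i,y_i\ge 0$. Then for each $1\le i\le s$: (1) if $x_i>0$, then $i\le q$; (2) if $y_i>0$, then the corresponding part size satisfies $L_i\le q$, and in particular $i\ge s-q+1$.
   Context: For an integer $m\ge 0$, $T_m:=m(m+1)/2$. Compressed form: a partition $\lambda$ is written $\lambda=(L_1^{m_1},\dots,L_r^{m_r})$ with $L_1>\cdots>L_r>0$ its distinct part sizes and $m_i\ge 1$ the multiplicity of $L_i$; its support size is $r$. Gaps: $g_i=L_i-L_{i+1}$ for $1\le i<r$ and $g_r=L_r$. Partition graph: for $n\ge 1$, $G_n$ is the simple graph whose vertices are the integer partitions of $n$; two distinct partitions are adjacent if one is obtained from the other by an elementary transfer of one unit from one part to another (subtract $1$ from one part and add $1$ to another part), followed by reordering. Here the receiving part may be a zero part (so a new part $1$ may be created), and parts that become $0$ are discarded. $\deg(\lambda)$ is the degree of $\lambda$ in $G_n$, and $\Delta_n:=\max_{\lambda\vdash n}\deg(\lambda)$. *)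

theory Defs
  imports "HOL-Library.Multiset"
begin

definition triangular :: "nat \<Rightarrow> nat"
  where "triangular m = m * (m + 1) div 2"

text \<open>A partition of \<open>n\<close> is the multiset of its (positive) parts.\<close>

definition partitions :: "nat \<Rightarrow> nat multiset set"
  where "partitions n = {\<nu>. 0 \<notin># \<nu> \<and> sum_mset \<nu> = n}"

text \<open>
  The receiving part \<open>b\<close> ranges over the remaining parts of \<open>\<nu>\<close> together with one zero part,
  so \<open>b\<close> may equal the giving part \<open>a\<close> only if \<open>a\<close> is repeated in \<open>\<nu>\<close>. The final filter discards
  zero parts.
\<close>

definition elementary_transfer :: "nat multiset \<Rightarrow> nat multiset \<Rightarrow> bool"
  where "elementary_transfer \<nu> \<mu> \<longleftrightarrow>
    (\<exists>a b. a \<in># \<nu> \<and> b \<in># add_mset 0 (\<nu> - {#a#}) \<and>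
       \<mu> = filter_mset (\<lambda>k. k \<noteq> 0) (add_mset 0 (\<nu> - {#a#}) - {#b#} + {#a - 1, b + 1#}))"

text \<open>The partition graph \<open>G\<^sub>n\<close> has vertex set \<^term>\<open>partitions n\<close> and the following edge relation.\<close>

definition adjacent :: "nat \<Rightarrow> nat multiset \<Rightarrow> nat multiset \<Rightarrow> bool"
  where "adjacent n \<nu> \<mu> \<longleftrightarrow>
    \<nu> \<in> partitions n \<and> \<mu> \<in> partitions n \<and> \<nu> \<noteq> \<mu> \<and>
    (elementary_transfer \<nu> \<mu> \<or> elementary_transfer \<mu> \<nu>)"

definition degree :: "nat \<Rightarrow> nat multiset \<Rightarrow> nat"
  where "degree n \<nu> = card {\<mu>. adjacent n \<nu> \<mu>}"

definition max_degree :: "nat \<Rightarrow> nat"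
  where "max_degree n = Max (degree n ` partitions n)"

text \<open>
  \<open>\<nu> = (L 1 ^ m 1, \<dots>, L r ^ m r)\<close> with support size \<open>r\<close>; only the values of \<open>L\<close> and \<open>m\<close> at
  \<open>1, \<dots>, r\<close> matter.
\<close>

definition compressed_form ::
    "nat multiset \<Rightarrow> nat \<Rightarrow> (nat \<Rightarrow> nat) \<Rightarrow> (nat \<Rightarrow> nat) \<Rightarrow> bool"
  where "compressed_form \<nu> r L m \<longleftrightarrow>
    (\<forall>i\<in>{1..r}. \<forall>j\<in>{1..r}. i < j \<longrightarrow> L i > L j) \<and>
    (\<forall>i\<in>{1..r}. L i > 0 \<and> m i \<ge> 1) \<and>
    \<nu> = (\<Sum>i=1..r. replicate_mset (m i) (L i))"

definition gap :: "nat \<Rightarrow> (nat \<Rightarrow> nat) \<Rightarrow> nat \<Rightarrow> nat"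
  where "gap r L i = (if i < r then L i - L (i + 1) else L r)"

text \<open>The maximum in \<^const>\<open>max_degree\<close> is over a finite set, and compressed forms always exist.\<close>

lemma finite_partitions: "finite (partitions n)"
proof -
  have "partitions n \<subseteq> mset ` {xs. set xs \<subseteq> {..n} \<and> length xs \<le> n}"
  proof
    fix M assume M: "M \<in> partitions n"
    obtain xs where xs: "M = mset xs" by (metis ex_mset)
    have 1: "0 \<notin> set xs" "sum_list xs = n"
      using M by (auto simp: partitions_def xs sum_mset_sum_list)
    have "length xs \<le> sum_list xs"
      using 1(1) by (induction xs) auto
    moreover have "set xs \<subseteq> {..n}"
      using 1(2) member_le_sum_list[of _ xs] by auto
    ultimately show "M \<in> mset ` {xs. set xs \<subseteq> {..n} \<and> length xs \<le> n}"
      using 1 xs by auto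
  qed
  thus ?thesis
    using finite_lists_length_le[of "{..n}" n] finite_surj by blast
qed

lemma compressed_form_exists:
  assumes "\<nu> \<in> partitions n"
  shows "\<exists>L m. compressed_form \<nu> (card (set_mset \<nu>)) L m"
proof -
  define xs where "xs = rev (sorted_list_of_set (set_mset \<nu>))"
  define L where "L i = xs ! (i - 1)" for i
  define r where "r = card (set_mset \<nu>)"
  have len: "length xs = r" and set: "set xs = set_mset \<nu>" and dist: "distinct xs"
    by (simp_all add: xs_def r_def)
  have "sorted_wrt (>) xs"
    unfolding xs_def sorted_wrt_rev using strict_sorted_list_of_set by (simp)
  hence dec: "L i > L j" if "i \<in> {1..r}" "j \<in> {1..r}" "i < j" for i j
    using that len sorted_wrt_nth_less[of "(>)" xs "i - 1" "j - 1"] unfolding L_def by auto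
  have inj: "inj_on L {1..r}"
    using dec by (metis inj_onI less_irrefl nat_neq_iff)
  have mem: "L ` {1..r} \<subseteq> set_mset \<nu>"
    unfolding L_def set[symmetric] using len by auto
  have img: "L ` {1..r} = set_mset \<nu>"
    using card_subset_eq[OF _ mem] card_image[OF inj] by (simp add: r_def)
  have "\<nu> = (\<Sum>x\<in>set_mset \<nu>. replicate_mset (count \<nu> x) x)"
    by (rule multiset_eqI) (simp add: count_sum not_in_iff)
  also have "\<dots> = (\<Sum>i=1..r. replicate_mset (count \<nu> (L i)) (L i))"
    unfolding img[symmetric] sum.reindex[OF inj] by simp
  finally have eq: "\<nu> = (\<Sum>i=1..r. replicate_mset (count \<nu> (L i)) (L i))" .
  have pos: "L i > 0 \<and> count \<nu> (L i) \<ge> 1" if "i \<in> {1..r}" for i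
  proof -
    have "L i \<in># \<nu>" using mem that by auto
    thus ?thesis using assms by (auto simp: partitions_def Suc_le_eq intro: gr0I)
  qed
  have "compressed_form \<nu> r L (\<lambda>i. count \<nu> (L i))"
    unfolding compressed_form_def using dec pos eq by blast
  thus ?thesis unfolding r_def by blast
qed

end

theory Submission
  imports Defs
begin

text \<open>
  A transfer from a part \<open>a\<close> to a part \<open>b\<close> changes the number of parts that are at least \<open>t\<close>
  by \<open>[t = b + 1] - [t = a]\<close>. Hence the transfers with \<open>b + 1 \<noteq> a\<close> lead to pairwise distinct
  neighbours, and a partition with \<open>r\<close> distinct part sizes has degree \<open>r (r - 1)\<close> plus the number of
  gaps \<open>> 1\<close> plus the number of multiplicities \<open>> 1\<close>. Summation by parts gives
  \<open>n = T\<^sub>r + (\<Sum>i. i x\<^sub>i) + (\<Sum>i. y\<^sub>i L\<^sub>i)\<close>, so \<open>r \<le> s\<close>. If \<open>r < s\<close>, the degree is at most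
  \<open>r (r + 1) \<le> s (s - 1)\<close>; the staircase with top part \<open>s + q\<close> forces equality and \<open>q = 0\<close>, so all
  \<open>x\<^sub>i\<close> and \<open>y\<^sub>i\<close> are positive, which makes \<open>n\<close> too large. With \<open>r = s\<close> the two weighted sums
  add up to \<open>q\<close>, which bounds each of their terms.
\<close>

section \<open>The degree of a partition\<close>

text \<open>The witness in \<open>elementary_transfer\<close> as a function of giver and receiver,
  so that neighbours can be counted through pairs.\<close>

definition transfer :: "nat multiset \<Rightarrow> nat \<Rightarrow> nat \<Rightarrow> nat multiset"
  where "transfer \<nu> a b =
    filter_mset (\<lambda>k. k \<noteq> 0) (add_mset 0 (\<nu> - {#a#}) - {#b#} + {#a - 1, b + 1#})"

lemma elementary_transfer_iff:
  "elementary_transfer \<nu> \<mu> \<longleftrightarrow>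
    (\<exists>a b. a \<in># \<nu> \<and> b \<in># add_mset 0 (\<nu> - {#a#}) \<and> \<mu> = transfer \<nu> a b)"
  by (simp add: elementary_transfer_def transfer_def)

text \<open>With a virtual zero part added, giver and receiver can be split off uniformly; later
  invariants compare both partitions over the same rest \<open>R\<close>.\<close>

lemma transfer_decompose:
  assumes "a \<in># \<nu>" "b \<in># add_mset 0 (\<nu> - {#a#})"
  obtains R where "add_mset 0 \<nu> = R + {#a, b#}"
    "transfer \<nu> a b = filter_mset (\<lambda>k. k \<noteq> 0) (R + {#a - 1, b + 1#})"
proof
  define R where "R = add_mset 0 (\<nu> - {#a#}) - {#b#}"
  have "add_mset b R = add_mset 0 (\<nu> - {#a#})"
    unfolding R_def using assms(2) by (rule insert_DiffM)
  hence "add_mset a (add_mset b R) = add_mset 0 (add_mset a (\<nu> - {#a#}))"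
    by (simp add: add_mset_commute)
  also have "\<dots> = add_mset 0 \<nu>"
    using assms(1) by simp
  finally show "add_mset 0 \<nu> = R + {#a, b#}"
    by (simp add: add_mset_commute)
  show "transfer \<nu> a b = filter_mset (\<lambda>k. k \<noteq> 0) (R + {#a - 1, b + 1#})"
    by (simp add: transfer_def R_def)
qed

lemma filter_nonzero_partition:
  assumes "0 \<notin># \<nu>"
  shows "filter_mset (\<lambda>k. k \<noteq> 0) (add_mset 0 \<nu>) = \<nu>"
  using assms by (intro multiset_eqI) (auto simp: count_eq_zero_iff)

lemma sum_mset_filter_nonzero:
  "sum_mset (filter_mset (\<lambda>k. k \<noteq> 0) M) = sum_mset (M :: nat multiset)"
  by (induction M) auto

lemma transfer_in_partitions:
  assumes "\<nu> \<in> partitions n" "a \<in># \<nu>" "b \<in># add_mset 0 (\<nu> - {#a#})"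
  shows "transfer \<nu> a b \<in> partitions n"
proof -
  obtain R where R: "add_mset 0 \<nu> = R + {#a, b#}"
    "transfer \<nu> a b = filter_mset (\<lambda>k. k \<noteq> 0) (R + {#a - 1, b + 1#})"
    using transfer_decompose assms(2,3) by blast
  have "a > 0" using assms by (auto simp: partitions_def intro: gr0I)
  moreover have "sum_mset (add_mset 0 \<nu>) = n"
    using assms(1) by (simp add: partitions_def)
  ultimately have "sum_mset (transfer \<nu> a b) = n"
    unfolding R(2) sum_mset_filter_nonzero by (simp add: R(1))
  moreover have "0 \<notin># transfer \<nu> a b" by (simp add: R(2))
  ultimately show ?thesis by (simp add: partitions_def)
qed

text \<open>The unit travels back from \<open>b + 1\<close> to \<open>a - 1\<close>. Hence only
  transfers out of a partition matter for its degree.\<close>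

lemma elementary_transfer_sym:
  assumes "\<mu> \<in> partitions n" "elementary_transfer \<mu> \<nu>"
  shows "elementary_transfer \<nu> \<mu>"
proof -
  let ?F = "filter_mset (\<lambda>k::nat. k \<noteq> 0)"
  obtain a b where ab: "a \<in># \<mu>" "b \<in># add_mset 0 (\<mu> - {#a#})" "\<nu> = transfer \<mu> a b"
    using assms(2) by (auto simp: elementary_transfer_iff)
  obtain R where R: "add_mset 0 \<mu> = R + {#a, b#}" "\<nu> = ?F (R + {#a - 1, b + 1#})"
    using transfer_decompose ab by metis
  have "a > 0" using assms ab by (auto simp: partitions_def intro: gr0I)
  have diff: "\<nu> - {#b + 1#} = ?F (R + {#a - 1#})"
    by (simp add: R(2) add_mset_commute)
  have 1: "b + 1 \<in># \<nu>" by (simp add: R(2))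
  have 2: "a - 1 \<in># add_mset 0 (\<nu> - {#b + 1#})"
    unfolding diff by simp
  \<comment> \<open>For \<open>a = 1\<close> the receiver is the added zero; otherwise it is a
    genuine part and the filter removes the leftover zero.\<close>
  have "?F (add_mset 0 (\<nu> - {#b + 1#}) - {#a - 1#}) = ?F R"
    unfolding diff by (cases "a - 1 = 0") (simp_all add: filter_filter_mset)
  moreover have "a - 1 + 1 = a" using \<open>a > 0\<close> by simp
  ultimately have "transfer \<nu> (b + 1) (a - 1) = ?F (R + {#a, b#})"
    unfolding transfer_def filter_union_mset by (simp only: add_diff_cancel_right' add_mset_commute)
  also have "\<dots> = \<mu>"
    unfolding R(1)[symmetric] using assms(1) by (intro filter_nonzero_partition) (simp add: partitions_def)
  finally show ?thesis
    unfolding elementary_transfer_iff using 1 2 by metis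
qed

text \<open>Discarded zeros are invisible because \<open>t > 0\<close>. Indicators on both sides
  avoid subtraction of naturals.\<close>

lemma size_transfer_ge:
  assumes "a \<in># \<nu>" "b \<in># add_mset 0 (\<nu> - {#a#})" "a > 0" "t > 0"
  shows "size (filter_mset (\<lambda>k. t \<le> k) (transfer \<nu> a b)) + of_bool (t = a) =
    size (filter_mset (\<lambda>k. t \<le> k) \<nu>) + of_bool (t = b + 1)"
proof -
  let ?N = "\<lambda>M. size (filter_mset (\<lambda>k. t \<le> k) M)"
  obtain R where R: "add_mset 0 \<nu> = R + {#a, b#}"
    "transfer \<nu> a b = filter_mset (\<lambda>k. k \<noteq> 0) (R + {#a - 1, b + 1#})"
    using transfer_decompose assms(1,2) by blast
  have "?N (transfer \<nu> a b) = ?N (R + {#a - 1, b + 1#})"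
    unfolding R(2) filter_filter_mset using assms(4)
    by (intro arg_cong[where f = size] filter_mset_cong) auto
  moreover have "?N \<nu> = ?N (R + {#a, b#})"
    unfolding R(1)[symmetric] using assms(4) by simp
  ultimately show ?thesis
    using assms(3) by auto
qed

lemma transfer_inject:
  assumes "a \<in># \<nu>" "b \<in># add_mset 0 (\<nu> - {#a#})" "a > 0" "a \<noteq> b + 1"
    and "c \<in># \<nu>" "d \<in># add_mset 0 (\<nu> - {#c#})" "c > 0" "c \<noteq> d + 1"
    and "transfer \<nu> a b = transfer \<nu> c d"
  shows "a = c \<and> b = d"
proof -
  have eq: "of_bool (t = b + 1) + of_bool (t = c) = (of_bool (t = d + 1) + of_bool (t = a) :: nat)"
    if "t > 0" for t
    using size_transfer_ge[OF assms(1-3) that] size_transfer_ge[OF assms(5-7) that] assms(9)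
    by (auto simp: of_bool_def split: if_splits)
  show ?thesis
    \<comment> \<open>As \<open>a \<noteq> b + 1\<close>, the count drops exactly at
      \<open>a\<close>, which gives \<open>a = c\<close>, and rises exactly at \<open>b + 1\<close>,
      which gives \<open>b = d\<close>.\<close>
    using eq[of a] eq[of "b + 1"] assms(3,4,7,8) by (auto simp: of_bool_def split: if_splits)
qed

lemma transfer_neq_self:
  assumes "a \<in># \<nu>" "b \<in># add_mset 0 (\<nu> - {#a#})" "a > 0" "a \<noteq> b + 1"
  shows "transfer \<nu> a b \<noteq> \<nu>"
  using size_transfer_ge[OF assms(1-3) assms(3)] assms(4) by auto

text \<open>The two parts merely exchange their values; this is why pairs with
  \<open>a = b + 1\<close> are left out of the degree count.\<close>

lemma transfer_self:
  assumes "0 \<notin># \<nu>" "b + 1 \<in># \<nu>" "b \<in># add_mset 0 (\<nu> - {#b + 1#})"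
  shows "transfer \<nu> (b + 1) b = \<nu>"
proof -
  obtain R where R: "add_mset 0 \<nu> = R + {#b + 1, b#}"
    "transfer \<nu> (b + 1) b = filter_mset (\<lambda>k. k \<noteq> 0) (R + {#b + 1 - 1, b + 1#})"
    using transfer_decompose assms(2,3) by blast
  have "R + {#b + 1 - 1, b + 1#} = add_mset 0 \<nu>"
    unfolding R(1) by (simp add: add_mset_commute)
  thus ?thesis
    unfolding R(2) using filter_nonzero_partition[OF assms(1)] by metis
qed

lemma receiver_iff:
  "b \<in># add_mset 0 (\<nu> - {#a#}) \<longleftrightarrow> b \<in> insert 0 (set_mset \<nu>) \<and> (b = a \<longrightarrow> b = 0 \<or> count \<nu> a \<ge> 2)"
  by (cases "b = a"; cases "b = 0") (auto simp: in_diff_count simp flip: count_greater_zero_iff)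

text \<open>Each giver \<open>a\<close> has the receivers \<open>insert 0 S\<close>, except
  \<open>a - 1\<close>, and except \<open>a\<close> itself unless it is repeated. The inserted zero
  makes the gap below a part 1 equal to 1.\<close>

lemma degree_eq:
  assumes "\<nu> \<in> partitions n"
  defines "S \<equiv> set_mset \<nu>"
  shows "degree n \<nu> = card S * (card S - 1) +
    card {a \<in> S. a - 1 \<notin> insert 0 S} + card {a \<in> S. count \<nu> a \<ge> 2}"
proof -
  have S0: "0 \<notin> S" and nz: "0 \<notin># \<nu>" using assms by (auto simp: partitions_def)
  have fin: "finite S" by (simp add: S_def)
  define B where "B a = {b. b \<in># add_mset 0 (\<nu> - {#a#}) \<and> a \<noteq> b + 1}" for a
  define P where "P = Sigma S B"
  have finB: "finite (B a)" for a
    by (rule finite_subset[of _ "set_mset (add_mset 0 (\<nu> - {#a#}))"]) (auto simp: B_def)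
  have "{\<mu>. adjacent n \<nu> \<mu>} = {\<mu>. \<mu> \<in> partitions n \<and> \<nu> \<noteq> \<mu> \<and> elementary_transfer \<nu> \<mu>}"
    using assms(1) elementary_transfer_sym by (auto simp: adjacent_def)
  also have "\<dots> = (\<lambda>(a, b). transfer \<nu> a b) ` P"
  proof (intro equalityI subsetI)
    fix \<mu> assume "\<mu> \<in> {\<mu>. \<mu> \<in> partitions n \<and> \<nu> \<noteq> \<mu> \<and> elementary_transfer \<nu> \<mu>}"
    then obtain a b where "\<mu> \<noteq> \<nu>" "a \<in># \<nu>" "b \<in># add_mset 0 (\<nu> - {#a#})" "\<mu> = transfer \<nu> a b"
      unfolding elementary_transfer_iff mem_Collect_eq by metis
    moreover from this have "a \<noteq> b + 1" using transfer_self nz by blast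
    ultimately have "(a, b) \<in> P" "\<mu> = transfer \<nu> a b" unfolding P_def B_def S_def by auto
    thus "\<mu> \<in> (\<lambda>(a, b). transfer \<nu> a b) ` P" by auto
  next
    fix \<mu> assume "\<mu> \<in> (\<lambda>(a, b). transfer \<nu> a b) ` P"
    then obtain a b where ab: "a \<in># \<nu>" "b \<in># add_mset 0 (\<nu> - {#a#})" "a \<noteq> b + 1"
      "\<mu> = transfer \<nu> a b"
      unfolding P_def B_def S_def by auto
    have "a > 0" using ab(1) nz by (metis gr0I)
    hence "\<mu> \<noteq> \<nu>" using transfer_neq_self ab by metis
    thus "\<mu> \<in> {\<mu>. \<mu> \<in> partitions n \<and> \<nu> \<noteq> \<mu> \<and> elementary_transfer \<nu> \<mu>}"
      using ab transfer_in_partitions[OF assms(1)] unfolding elementary_transfer_iff mem_Collect_eq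
      by metis
  qed
  finally have "degree n \<nu> = card ((\<lambda>(a, b). transfer \<nu> a b) ` P)"
    by (simp add: degree_def)
  also have "\<dots> = card P"
  proof (intro card_image inj_onI, clarify)
    fix a b c d assume "(a, b) \<in> P" "(c, d) \<in> P" "transfer \<nu> a b = transfer \<nu> c d"
    moreover from this have "a > 0" "c > 0" using S0 by (auto simp: P_def intro: gr0I)
    ultimately show "a = c \<and> b = d"
      using transfer_inject[of a \<nu> b c d] by (simp add: P_def B_def S_def)
  qed
  also have "\<dots> = (\<Sum>a\<in>S. card (B a))"
    unfolding P_def using fin finB by (simp add: card_SigmaI)
  \<comment> \<open>The baseline \<open>card S - 1\<close> excludes both \<open>a - 1\<close> and
    \<open>a\<close>; each indicator restores one receiver when its exclusion does not
    apply.\<close>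
  also have "\<dots> = (\<Sum>a\<in>S. (card S - 1) + of_bool (a - 1 \<notin> insert 0 S) + of_bool (count \<nu> a \<ge> 2))"
  proof (rule sum.cong[OF refl])
    fix a assume a: "a \<in> S"
    hence "a > 0" using S0 by (auto intro: gr0I)
    have B: "B a = insert 0 S - ({a - 1} \<union> (if count \<nu> a \<ge> 2 then {} else {a}))"
      unfolding B_def receiver_iff S_def[symmetric] using \<open>a > 0\<close> by auto
    have "card S > 0" using a fin by (auto simp: card_gt_0_iff)
    moreover have "card (insert 0 S) = card S + 1" using S0 fin by simp
    moreover have "insert 0 S - ({a - 1} \<union> {a}) = insert 0 S - {a - 1} - {a}" by auto
    ultimately show "card (B a) =
      (card S - 1) + of_bool (a - 1 \<notin> insert 0 S) + of_bool (count \<nu> a \<ge> 2)"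
      unfolding B using a fin \<open>a > 0\<close>
      by (cases "count \<nu> a \<ge> 2"; cases "a - 1 \<in> insert 0 S") (simp_all add: card_Diff_singleton_if)
  qed
  also have "\<dots> = card S * (card S - 1) +
    card {a \<in> S. a - 1 \<notin> insert 0 S} + card {a \<in> S. count \<nu> a \<ge> 2}"
    using fin by (simp add: sum.distrib of_bool_def sum.If_cases Int_def conj_commute)
  finally show ?thesis .
qed

section \<open>Triangular numbers and a lower bound for the maximal degree\<close>

lemma triangular_Suc: "triangular (Suc k) = triangular k + Suc k"
  by (simp add: triangular_def)

lemma triangular_mono: "j \<le> k \<Longrightarrow> triangular j \<le> triangular k"
  by (induction rule: dec_induct) (auto simp: triangular_Suc)

lemma sum_triangular: "(\<Sum>i=1..k. i) = triangular k"
  by (induction k) (auto simp: triangular_def)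

lemma max_degree_staircase:
  assumes "s \<ge> 1"
  shows "max_degree (triangular s + q) \<ge> s * (s - 1) + of_bool (q > 0)"
proof -
  \<comment> \<open>The staircase with all the excess put on its top part: for \<open>q > 0\<close>
    the top gap exceeds 1 and contributes one more neighbour.\<close>
  define \<nu> where "\<nu> = add_mset (s + q) (mset_set {1..s - 1})"
  define S where "S = insert (s + q) {1..s - 1}"
  have S: "set_mset \<nu> = S" by (simp add: \<nu>_def S_def)
  have card: "card S = s" using assms by (simp add: S_def)
  have "sum_mset (mset_set {1..s - 1}) = triangular (s - 1)"
    using sum_triangular[of "s - 1"] by (simp add: sum_unfold_sum_mset)
  hence "sum_mset \<nu> = triangular s + q"
    using assms by (cases s) (simp_all add: \<nu>_def triangular_Suc)
  hence part: "\<nu> \<in> partitions (triangular s + q)"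
    using assms by (simp add: partitions_def \<nu>_def)
  have "of_bool (q > 0) \<le> card {a \<in> S. a - 1 \<notin> insert 0 S}"
  proof (cases "q > 0")
    case True
    hence "{s + q} \<subseteq> {a \<in> S. a - 1 \<notin> insert 0 S}"
      using assms by (auto simp: S_def)
    from card_mono[OF _ this] show ?thesis by (simp add: S_def)
  qed simp
  hence "s * (s - 1) + of_bool (q > 0) \<le> degree (triangular s + q) \<nu>"
    unfolding degree_eq[OF part] S card by simp
  also have "\<dots> \<le> max_degree (triangular s + q)"
    unfolding max_degree_def using part finite_partitions by (intro Max_ge) auto
  finally show ?thesis .
qed

section \<open>Compressed forms\<close>

lemma compressed_form_inj:
  assumes "compressed_form \<nu> r L m"
  shows "inj_on L {1..r}"
proof (rule linorder_inj_onI')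
  fix i j assume "i \<in> {1..r}" "j \<in> {1..r}" "i < j"
  moreover have "\<forall>i\<in>{1..r}. \<forall>j\<in>{1..r}. i < j \<longrightarrow> L i > L j"
    using assms unfolding compressed_form_def by (elim conjE)
  ultimately have "L i > L j" by blast
  thus "L i \<noteq> L j" by simp
qed

lemma compressed_form_set_mset:
  assumes "compressed_form \<nu> r L m"
  shows "set_mset \<nu> = L ` {1..r}"
proof -
  have pos: "m i \<noteq> 0" if "i \<in> {1..r}" for i
  proof -
    have "\<forall>i\<in>{1..r}. L i > 0 \<and> m i \<ge> 1"
      using assms unfolding compressed_form_def by (elim conjE)
    from bspec[OF this that] show ?thesis by simp
  qed
  have "set_mset \<nu> = (\<Union>i\<in>{1..r}. set_mset (replicate_mset (m i) (L i)))"
    using assms by (simp add: compressed_form_def set_mset_sum)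
  also have "\<dots> = (\<Union>i\<in>{1..r}. {L i})"
    using pos by (intro SUP_cong refl) simp
  finally show ?thesis by blast
qed

lemma compressed_form_count:
  assumes "compressed_form \<nu> r L m" "i \<in> {1..r}"
  shows "count \<nu> (L i) = m i"
proof -
  have "\<nu> = (\<Sum>j=1..r. replicate_mset (m j) (L j))"
    using assms(1) unfolding compressed_form_def by (elim conjE)
  hence "count \<nu> (L i) = (\<Sum>j=1..r. if L i = L j then m j else 0)"
    by (simp add: count_sum)
  also have "\<dots> = (\<Sum>j=1..r. if j = i then m j else 0)"
    using inj_on_eq_iff[OF compressed_form_inj[OF assms(1)] assms(2)]
    by (intro sum.cong refl if_cong) auto
  finally show ?thesis using assms(2) by simp
qed

text \<open>Since \<open>L\<close> drops by at least 1 per step, \<open>i + L i\<close> never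
  increases with \<open>i\<close>; the induction runs downwards from \<open>r\<close>.\<close>

lemma compressed_form_lower:
  assumes "compressed_form \<nu> r L m" "i \<in> {1..r}"
  shows "r + L r \<le> i + L i"
proof -
  have "d < r \<Longrightarrow> r + L r \<le> (r - d) + L (r - d)" for d
  proof (induction d)
    case (Suc d)
    have "L (r - Suc d) > L (r - d)"
      using assms(1) Suc.prems unfolding compressed_form_def by auto
    thus ?case using Suc by simp
  qed simp
  from this[of "r - i"] assms(2) show ?thesis by simp
qed

lemma sum_gaps:
  assumes "compressed_form \<nu> r L m"
  shows "(\<Sum>i=1..r. i * gap r L i) = (\<Sum>i=1..r. L i)"
proof -
  \<comment> \<open>Summation by parts with its boundary term; the last gap, \<open>L r\<close>,
    absorbs that term at \<open>k = r - 1\<close>.\<close>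
  have "k < r \<Longrightarrow> (\<Sum>i=1..k. i * gap r L i) + k * L (k + 1) = (\<Sum>i=1..k. L i)" for k
  proof (induction k)
    case (Suc k)
    have "L (Suc k) > L (Suc k + 1)"
      using assms Suc.prems unfolding compressed_form_def by auto
    hence "gap r L (Suc k) + L (Suc k + 1) = L (Suc k)"
      using Suc.prems by (simp add: gap_def)
    hence "Suc k * gap r L (Suc k) + Suc k * L (Suc k + 1) = Suc k * L (Suc k)"
      by (metis distrib_left)
    thus ?case using Suc by simp
  qed simp
  from this[of "r - 1"] show ?thesis
    by (cases r) (auto simp: gap_def)
qed

lemma partition_excess:
  assumes "\<nu> \<in> partitions n" "compressed_form \<nu> r L m"
    and x: "\<forall>i\<in>{1..r}. gap r L i = 1 + x i" and y: "\<forall>i\<in>{1..r}. m i = 1 + y i"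
  shows "n = triangular r + (\<Sum>i=1..r. i * x i) + (\<Sum>i=1..r. y i * L i)"
proof -
  have smr: "sum_mset (\<Sum>i\<in>I. replicate_mset (m i) (L i)) = (\<Sum>i\<in>I. m i * L i)"
    if "finite I" for I
    using that by (induction I) auto
  have "n = sum_mset \<nu>" using assms(1) by (simp add: partitions_def)
  also have "\<dots> = (\<Sum>i=1..r. m i * L i)"
    using assms(2) smr by (simp add: compressed_form_def)
  also have "\<dots> = (\<Sum>i=1..r. L i) + (\<Sum>i=1..r. y i * L i)"
    using y by (simp add: sum.distrib)
  also have "(\<Sum>i=1..r. L i) = (\<Sum>i=1..r. i + i * x i)"
    unfolding sum_gaps[OF assms(2), symmetric] using x by (intro sum.cong) auto
  also have "\<dots> = triangular r + (\<Sum>i=1..r. i * x i)"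
    unfolding sum.distrib sum_triangular ..
  finally show ?thesis .
qed

section \<open>Partitions of maximal degree\<close>

lemma max_degree_support_size:
  assumes "s \<ge> 1" "q \<le> s" "n = triangular s + q" "\<nu> \<in> partitions n"
    and deg: "degree n \<nu> = max_degree n" and cf: "compressed_form \<nu> r L m"
    and x: "\<forall>i\<in>{1..r}. gap r L i = 1 + x i" and y: "\<forall>i\<in>{1..r}. m i = 1 + y i"
  shows "r = s"
proof (rule antisym)
  note n_eq = partition_excess[OF assms(4) cf x y]
  show "r \<le> s"
  proof (rule ccontr)
    assume "\<not> r \<le> s"
    \<comment> \<open>Impossible, as \<open>q \<le> s\<close> keeps \<open>n\<close> below the next
      triangular number.\<close>
    hence "triangular (Suc s) \<le> n" using triangular_mono[of "Suc s" r] n_eq by simp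
    thus False using assms(2,3) by (simp add: triangular_Suc)
  qed
  show "s \<le> r"
  proof (rule ccontr)
    assume "\<not> s \<le> r"
    hence rs: "Suc r \<le> s" by simp
    define S where "S = set_mset \<nu>"
    define A where "A = {a \<in> S. a - 1 \<notin> insert 0 S}"
    define B where "B = {a \<in> S. count \<nu> a \<ge> 2}"
    have S: "S = L ` {1..r}" unfolding S_def by (rule compressed_form_set_mset[OF cf])
    have fin: "finite S" and cardS: "card S = r"
      using card_image[OF compressed_form_inj[OF cf]] by (simp_all add: S)
    have sub: "A \<subseteq> S" "B \<subseteq> S" by (auto simp: A_def B_def)
    hence le: "card A \<le> r" "card B \<le> r" using card_mono[OF fin] cardS by auto
    have "degree n \<nu> = r * (r - 1) + card A + card B"
      using degree_eq[OF assms(4)] by (simp add: A_def B_def S_def[symmetric] cardS)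
    hence low: "s * (s - 1) + of_bool (q > 0) \<le> r * (r - 1) + card A + card B"
      using max_degree_staircase[OF assms(1), of q] deg assms(3) by simp
    have rr: "r * (r - 1) + 2 * r = Suc r * r" by (cases r) auto
    \<comment> \<open>The upper bound for the degree thus meets the staircase bound, so every
      estimate is an equality.\<close>
    have "Suc r * r \<le> s * (s - 1)" using rs by (intro mult_le_mono) auto
    hence q: "q = 0" and full: "card A = r" "card B = r" and ss: "s * (s - 1) = Suc r * r"
      using low le rr by (auto simp: of_bool_def split: if_splits)
    have s: "s = Suc r"
    proof (rule ccontr)
      assume "s \<noteq> Suc r"
      hence "Suc (Suc r) * Suc r \<le> s * (s - 1)" using rs by (intro mult_le_mono) auto
      thus False using ss by simp
    qed
    have n: "n = triangular r + Suc r" using assms(3) q s by (simp add: triangular_Suc)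
    hence "r \<noteq> 0" using n_eq by (cases "r = 0") auto
    hence r: "1 \<in> {1..r}" "r \<in> {1..r}" by auto
    have AB: "A = S" "B = S" using full sub fin cardS card_subset_eq by metis+
    \<comment> \<open>Two terms suffice for the contradiction: the gap at the smallest part adds at
      least \<open>r\<close>, the repeated largest part at least \<open>r + 1\<close>, but the total
      excess is only \<open>r + 1\<close>.\<close>
    have "L r \<in> A" "L 1 \<in> B" unfolding AB S using r by blast+
    hence "L r \<ge> 2" "count \<nu> (L 1) \<ge> 2" unfolding A_def B_def by auto
    moreover have "L r = 1 + x r" using bspec[OF x r(2)] by (simp add: gap_def)
    ultimately have xy: "x r \<ge> 1" "y 1 \<ge> 1" "L 1 \<ge> r + 1"
      using compressed_form_count[OF cf r(1)] y r compressed_form_lower[OF cf r(1)] by auto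
    have "r * 1 \<le> r * x r" using xy by (intro mult_le_mono) auto
    also have "\<dots> \<le> (\<Sum>i=1..r. i * x i)"
      using r by (intro member_le_sum) auto
    finally have 1: "r \<le> (\<Sum>i=1..r. i * x i)" by simp
    have "1 * (r + 1) \<le> y 1 * L 1" using xy by (intro mult_le_mono) auto
    also have "\<dots> \<le> (\<Sum>i=1..r. y i * L i)"
      using r by (intro member_le_sum) auto
    finally have "r + 1 \<le> (\<Sum>i=1..r. y i * L i)" by simp
    with 1 n n_eq \<open>r \<noteq> 0\<close> show False by simp
  qed
qed

theorem lemma7p8:
  fixes s q n r :: nat and \<nu> :: "nat multiset" and L m x y :: "nat \<Rightarrow> nat"
  assumes "s \<ge> 1" and "q \<le> s" and "n = triangular s + q"
    and "\<nu> \<in> partitions n" and "degree n \<nu> = max_degree n"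
    and "compressed_form \<nu> r L m"
    and "\<forall>i\<in>{1..r}. gap r L i = 1 + x i"
    and "\<forall>i\<in>{1..r}. m i = 1 + y i"
  shows "r = s \<and>
    (\<forall>i\<in>{1..s}.
      (x i > 0 \<longrightarrow> i \<le> q) \<and>
      (y i > 0 \<longrightarrow> L i \<le> q \<and> i \<ge> s - q + 1))"
proof (intro conjI ballI impI)
  show rs: "r = s" using max_degree_support_size assms by blast
  have q: "q = (\<Sum>i=1..r. i * x i) + (\<Sum>i=1..r. y i * L i)"
    using partition_excess[OF assms(4,6,7,8)] assms(3) rs by simp
  fix i assume "i \<in> {1..s}"
  hence i: "i \<in> {1..r}" using rs by simp
  show "i \<le> q" if "x i > 0"
  proof -
    have "i * 1 \<le> i * x i" using that by (intro mult_le_mono) auto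
    also have "\<dots> \<le> (\<Sum>i=1..r. i * x i)" using i by (intro member_le_sum) auto
    finally show ?thesis using q by simp
  qed
  show L: "L i \<le> q" if "y i > 0"
  proof -
    have "1 * L i \<le> y i * L i" using that by (intro mult_le_mono) auto
    also have "\<dots> \<le> (\<Sum>i=1..r. y i * L i)" using i by (intro member_le_sum) auto
    finally show ?thesis using q by simp
  qed
  show "i \<ge> s - q + 1" if "y i > 0"
  proof -
    \<comment> \<open>Now \<open>s + 1 \<le> i + L i \<le> i + q\<close>, and
      \<open>q \<le> s\<close> makes \<open>s - q\<close> a true difference.\<close>
    have "L r > 0" using assms(6) i unfolding compressed_form_def by auto
    thus ?thesis using compressed_form_lower[OF assms(6) i] L[OF that] rs assms(2) by simp
  qed
qed

end
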